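(* Let $k\ge 1$ and let $n_1\le n_2\le\cdots\le n_k$ be positive integers. Then $$\sum_{i=1}^{\lceil k/2\rceil} n_i\ \le\ \operatorname{tdepth}\llbracket n_1,n_2,\dots,n_k\rrbracket\ \le\ \sum_{i=k-\lceil k/2\rceil+1}^{k} n_i.$$
   Context: For positive integers $n_1,\dots,n_k$, let $\llbracket n_1,\dots,n_k\rrbracket$ denote the poset of nonempty submultisets of the multiset $\{1^{n_1},\dots,k^{n_k}\}$ ordered by inclusion; equivalently, the set of nonzero tuples $(a_1,\dots,a_k)$ of integers with $0\le a_j\le n_j$ for all $j$, ordered componentwise. An interval in a finite poset $P$ is a set $[X,Y]=\{Z\in P: X\le Z\le Y\}$ with $X\le Y$ in $P$; $Y$ is its top element. An interval partition of $P$ is a partition of $P$ into nonempty pairwise disjoint intervals. The height of $Z\in P$ is the maximal size $n$ of a chain $Z=Z_1>Z_2>\cdots>Z_n$ in $P$ (in $\llbracket n_1,\dots,n_k\rrbracket$ the height of $(z_1,\dots,z_k)$ is $z_1+\cdots+z_k$). The total depth of an interval partition $\pi$ is $\operatorname{tdepth}\pi=\min_{[X,Y]\in\pi}\operatorname{height}Y$, and the total depth of $P$ is $\operatorname{tdepth}P=\max_\pi\operatorname{tdepth}\pi$ over all interval partitions $\pi$ of $P$. *)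

theory Defs
  imports Complex_Main "HOL-Library.Disjoint_Sets"
begin

text \<open>
  A finite poset is a finite set \<open>P\<close> over a type of class \<open>order\<close>, with the induced order. The
  operators \<open>Max\<close> and \<open>Min\<close> below are meaningful because \<open>P\<close> is finite and nonempty: then strictly
  decreasing lists in \<open>P\<close> are of bounded length, and \<open>P\<close> has only finitely many interval partitions,
  among them the partition into singletons.
\<close>

definition poset_interval :: "'a::order set \<Rightarrow> 'a \<Rightarrow> 'a \<Rightarrow> 'a set" where
  "poset_interval P X Y = {Z \<in> P. X \<le> Z \<and> Z \<le> Y}"

definition interval_partition :: "'a::order set \<Rightarrow> 'a set set \<Rightarrow> bool" where
  "interval_partition P \<pi> \<longleftrightarrow> partition_on P \<pi> \<and>
     (\<forall>I\<in>\<pi>. \<exists>X\<in>P. \<exists>Y\<in>P. X \<le> Y \<and> I = poset_interval P X Y)"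

text \<open>A chain \<open>Z = Z\<^sub>1 > Z\<^sub>2 > \<dots> > Z\<^sub>n\<close> is the list of its elements; its size is the number \<open>n\<close> of elements.\<close>

definition height :: "'a::order set \<Rightarrow> 'a \<Rightarrow> nat" where
  "height P Z = Max {length zs |zs. zs \<noteq> [] \<and> hd zs = Z \<and> set zs \<subseteq> P \<and> sorted_wrt (>) zs}"

definition tdepth_partition :: "'a::order set \<Rightarrow> 'a set set \<Rightarrow> nat" where
  "tdepth_partition P \<pi> =
     Min {height P Y |X Y. X \<in> P \<and> Y \<in> P \<and> X \<le> Y \<and> poset_interval P X Y \<in> \<pi>}"

definition tdepth :: "'a::order set \<Rightarrow> nat" where
  "tdepth P = Max {tdepth_partition P \<pi> |\<pi>. interval_partition P \<pi>}"

text \<open>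
  A submultiset of \<open>{1\<^sup>n\<^sup>1, \<dots>, k\<^sup>n\<^sup>k}\<close> is given by its multiplicities, i.e. by a tuple \<open>(a 1, \<dots>, a k)\<close>.
  Tuples are functions on \<open>nat\<close> vanishing outside \<open>{1..k}\<close>, so that the order \<open>\<le>\<close> on functions is
  the componentwise order.
\<close>

definition multiset_poset :: "nat \<Rightarrow> (nat \<Rightarrow> nat) \<Rightarrow> (nat \<Rightarrow> nat) set" where
  "multiset_poset k n =
     {a. (\<forall>j\<in>{1..k}. a j \<le> n j) \<and> (\<forall>j. j \<notin> {1..k} \<longrightarrow> a j = 0) \<and> (\<exists>j. a j \<noteq> 0)}"

end

theory Submission
  imports Defs
begin

text \<open>
  Both bounds come from looking only at the supports of the tuples.

  Upper bound. The unit tuple at \<open>i\<close> is minimal, so it is the bottom of its block; let \<open>Y\<^sub>i\<close> be the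
  top of that block. If \<open>Y\<^sub>i\<close> and \<open>Y\<^sub>j\<close> were positive at \<open>j\<close> and at \<open>i\<close> respectively, then the sum of
  the two unit tuples would lie in both blocks. Hence ``\<open>Y\<^sub>i\<close> is positive at \<open>j\<close>'' is an asymmetric
  relation between distinct indices, and some \<open>i\<close> has at most \<open>(k - 1) / 2\<close> successors
  (\<open>asymmetric_relation_small_outdegree\<close>). The support of this \<open>Y\<^sub>i\<close> has at most \<open>\<lceil>k / 2\<rceil>\<close> elements, so
  its height is at most the sum of the \<open>\<lceil>k / 2\<rceil>\<close> largest multiplicities.

  Lower bound. A set interval \<open>[L, H]\<close> lifts to the interval between the indicator of \<open>L\<close> and the
  tuple that equals \<open>n\<close> on \<open>H\<close> and \<open>0\<close> elsewhere: it consists of the tuples whose support lies in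
  \<open>[L, H]\<close>. So it suffices to partition the nonempty subsets of \<open>{1..k}\<close> into intervals whose tops
  have at least \<open>\<lceil>k / 2\<rceil>\<close> elements. Put \<open>1, \<dots>, k\<close> on a circle, with one further point if \<open>k\<close> is even,
  so that the circle is odd. Given \<open>A\<close>, let \<open>L\<close> consist of the elements of \<open>A\<close> at odd distance
  from their predecessor in \<open>A\<close>, and \<open>H\<close> of the points at even distance from the last element of \<open>A\<close>
  at or before them. The distances add up to the odd length of the circle, so \<open>L\<close> is not empty.
  Adding or removing points of \<open>H - L\<close> changes neither set, as such points sit at even distance
  from their predecessors; thus the intervals \<open>[L, H]\<close> form a partition
  (\<open>bounds_eq_if_between\<close>). Of two neighbours on the circle at least one lies in \<open>H\<close>, so \<open>H\<close> contains
  more than half of the odd circle, and at least \<open>\<lceil>k / 2\<rceil>\<close> elements without the further point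
  (\<open>card_upper\<close>).

  On a line, the circle is replaced by a parity that is updated while reading \<open>1, \<dots>, k\<close>
  (\<open>last_parity\<close>): going once around an odd circle flips parities, so reading starts with the
  opposite of the parity with which it ends.
\<close>

section \<open>Depth of finite posets\<close>

lemma finite_interval_partitions:
  assumes "finite P"
  shows "finite {\<pi>. interval_partition P \<pi>}"
proof (rule finite_subset)
  show "{\<pi>. interval_partition P \<pi>} \<subseteq> Pow (Pow P)"
    by (auto simp: interval_partition_def partition_on_def)
qed (use assms in auto)

lemma finite_top_heights:
  assumes "finite P"
  shows "finite {height P Y |X Y. X \<in> P \<and> Y \<in> P \<and> X \<le> Y \<and> poset_interval P X Y \<in> \<pi>}"
  by (rule finite_subset[of _ "height P ` P"]) (use assms in auto)

lemma tdepth_partition_le: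
  assumes "finite P" "X \<in> P" "Y \<in> P" "X \<le> Y" "poset_interval P X Y \<in> \<pi>"
  shows "tdepth_partition P \<pi> \<le> height P Y"
  unfolding tdepth_partition_def
  by (rule Min_le) (use assms finite_top_heights in auto)

lemma tdepth_partition_ge:
  assumes "finite P" "P \<noteq> {}" "interval_partition P \<pi>"
    and "\<And>X Y. X \<in> P \<Longrightarrow> Y \<in> P \<Longrightarrow> X \<le> Y \<Longrightarrow> poset_interval P X Y \<in> \<pi> \<Longrightarrow> s \<le> height P Y"
  shows "s \<le> tdepth_partition P \<pi>"
proof -
  let ?S = "{height P Y |X Y. X \<in> P \<and> Y \<in> P \<and> X \<le> Y \<and> poset_interval P X Y \<in> \<pi>}"
  have "\<pi> \<noteq> {}"
    using assms(2,3) by (auto simp: interval_partition_def partition_on_def)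
  then obtain I where I: "I \<in> \<pi>"
    by blast
  then obtain X Y where "X \<in> P" "Y \<in> P" "X \<le> Y" "I = poset_interval P X Y"
    using assms(3) unfolding interval_partition_def by meson
  then have "height P Y \<in> ?S"
    using I by blast
  then have "Min ?S \<in> ?S"
    by (intro Min_in finite_top_heights assms(1)) blast
  then obtain X Y where min: "Min ?S = height P Y"
    and "X \<in> P" "Y \<in> P" "X \<le> Y" "poset_interval P X Y \<in> \<pi>"
    by blast
  show ?thesis
    unfolding tdepth_partition_def min by (rule assms(4)) fact+
qed

lemma tdepth_partition_le_tdepth:
  assumes "finite P" "interval_partition P \<pi>"
  shows "tdepth_partition P \<pi> \<le> tdepth P"
  unfolding tdepth_def
  using assms by (intro Max_ge finite_image_set finite_interval_partitions) blast+

lemma tdepth_le: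
  assumes "finite P" "interval_partition P \<pi>"
    and "\<And>\<rho>. interval_partition P \<rho> \<Longrightarrow> tdepth_partition P \<rho> \<le> s"
  shows "tdepth P \<le> s"
proof -
  have "finite {tdepth_partition P \<pi> |\<pi>. interval_partition P \<pi>}"
    using finite_interval_partitions[OF assms(1)] by (rule finite_image_set)
  then show ?thesis
    unfolding tdepth_def using assms(2,3) by (intro Max.boundedI) blast+
qed

lemma poset_interval_eqD:
  assumes "X \<in> P" "Y \<in> P" "X \<le> Y" "X' \<in> P" "Y' \<in> P" "X' \<le> Y'"
    and "poset_interval P X Y = poset_interval P X' Y'"
  shows "X = X'" "Y = Y'"
proof -
  have "X \<in> poset_interval P X' Y'" "Y \<in> poset_interval P X' Y'"
    unfolding assms(7)[symmetric] using assms(1-3) by (auto simp: poset_interval_def)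
  moreover have "X' \<in> poset_interval P X Y" "Y' \<in> poset_interval P X Y"
    unfolding assms(7) using assms(4-6) by (auto simp: poset_interval_def)
  ultimately show "X = X'" "Y = Y'"
    by (simp_all add: poset_interval_def antisym)
qed

text \<open>
  A pair of maps that assigns to each element an interval around it, and is constant on
  each of these intervals, has the intervals as its fibres.
\<close>

lemma interval_partition_of_bounds:
  fixes P :: "'a::order set"
  assumes "\<And>a. a \<in> P \<Longrightarrow> lo a \<in> P \<and> hi a \<in> P \<and> lo a \<le> a \<and> a \<le> hi a"
    and const: "\<And>a b. a \<in> P \<Longrightarrow> b \<in> P \<Longrightarrow> lo a \<le> b \<Longrightarrow> b \<le> hi a \<Longrightarrow> lo b = lo a \<and> hi b = hi a"
  shows "interval_partition P ((\<lambda>a. poset_interval P (lo a) (hi a)) ` P)"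
proof -
  let ?I = "\<lambda>a. poset_interval P (lo a) (hi a)"
  have mem: "a \<in> ?I a" if "a \<in> P" for a
    using assms(1)[OF that] that by (simp add: poset_interval_def)
  have eq: "?I b = ?I a" if "a \<in> P" "b \<in> ?I a" for a b
    using const[of a b] that by (simp add: poset_interval_def)
  have "partition_on P (?I ` P)"
  proof (rule partition_onI)
    show "\<Union> (?I ` P) = P"
      using mem by (auto simp: poset_interval_def)
    show "disjnt p q" if pq: "p \<in> ?I ` P" "q \<in> ?I ` P" "p \<noteq> q" for p q
    proof -
      obtain a b where ab: "a \<in> P" "b \<in> P" "p = ?I a" "q = ?I b"
        using pq(1,2) by blast
      have "c \<notin> q" if "c \<in> p" for c
        using eq[OF ab(1), of c] eq[OF ab(2), of c] that pq(3) unfolding ab(3,4) by metis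
      then show ?thesis
        by (auto simp: disjnt_def)
    qed
    show "{} \<notin> ?I ` P"
      using mem by auto
  qed
  moreover have "\<exists>X\<in>P. \<exists>Y\<in>P. X \<le> Y \<and> I = poset_interval P X Y" if I: "I \<in> ?I ` P" for I
  proof -
    obtain a where a: "a \<in> P" "I = ?I a"
      using I by blast
    then show ?thesis
      using assms(1)[OF a(1)] order_trans[of "lo a" a "hi a"] by blast
  qed
  ultimately show ?thesis
    by (simp add: interval_partition_def)
qed

section \<open>Tuples and their heights\<close>

lemma finite_multiset_poset: "finite (multiset_poset k n)"
proof (rule finite_subset)
  show "multiset_poset k n \<subseteq>
      {a. \<forall>j. (j \<in> {1..k} \<longrightarrow> a j \<in> {..sum n {1..k}}) \<and> (j \<notin> {1..k} \<longrightarrow> a j = 0)}"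
  proof
    fix a assume a: "a \<in> multiset_poset k n"
    have "a j \<le> sum n {1..k}" if "j \<in> {1..k}" for j
    proof -
      have "a j \<le> n j"
        using a that by (simp add: multiset_poset_def)
      also have "\<dots> \<le> sum n {1..k}"
        using that by (intro member_le_sum) auto
      finally show ?thesis .
    qed
    then show "a \<in> {a. \<forall>j. (j \<in> {1..k} \<longrightarrow> a j \<in> {..sum n {1..k}}) \<and> (j \<notin> {1..k} \<longrightarrow> a j = 0)}"
      using a by (auto simp: multiset_poset_def)
  qed
qed (intro finite_set_of_finite_funs; simp)

lemma sum_strict_mono_multiset_poset:
  assumes "a \<in> multiset_poset k n" "b \<in> multiset_poset k n" "a < b"
  shows "sum a {1..k} < sum b {1..k}"
proof (rule sum_strict_mono_ex1)
  show "\<forall>j\<in>{1..k}. a j \<le> b j"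
    using assms(3) by (auto simp: less_le le_fun_def)
  obtain j where "a j < b j"
    using assms(3) by (auto simp: less_fun_def le_fun_def not_le)
  moreover from this have "j \<in> {1..k}"
    using assms(2) by (force simp: multiset_poset_def)
  ultimately show "\<exists>j\<in>{1..k}. a j < b j"
    by blast
qed simp

lemma multiset_poset_sum_pos:
  assumes "a \<in> multiset_poset k n"
  shows "0 < sum a {1..k}"
proof -
  obtain j where "a j \<noteq> 0"
    using assms by (auto simp: multiset_poset_def)
  then have "j \<in> {1..k}" "0 < a j"
    using assms by (auto simp: multiset_poset_def)
  then show ?thesis
    by (intro sum_pos2[of _ j]) auto
qed

lemma length_chain_le:
  assumes "zs \<noteq> []" "set zs \<subseteq> multiset_poset k n" "sorted_wrt (>) zs"
  shows "length zs \<le> sum (hd zs) {1..k}"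
  using assms
proof (induction zs)
  case (Cons z zs)
  show ?case
  proof (cases zs)
    case Nil
    then show ?thesis
      using Cons.prems multiset_poset_sum_pos[of z k n] by simp
  next
    case (Cons w ws)
    then have "length zs \<le> sum w {1..k}" "sum w {1..k} < sum z {1..k}"
      using Cons.prems Cons.IH sum_strict_mono_multiset_poset[of w k n z] by auto
    then show ?thesis
      by simp
  qed
qed simp

text \<open>Lowering one entry by one at a time gives a chain without jumps.\<close>

lemma ex_chain_of_length_sum:
  assumes "a \<in> multiset_poset k n"
  shows "\<exists>zs. zs \<noteq> [] \<and> hd zs = a \<and> set zs \<subseteq> multiset_poset k n \<and> sorted_wrt (>) zs \<and>
    length zs = sum a {1..k}"
  using assms
proof (induction "sum a {1..k}" arbitrary: a rule: less_induct)
  case less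
  note a = less.prems
  show ?case
  proof (cases "sum a {1..k} = 1")
    case True
    then show ?thesis
      using a by (intro exI[of _ "[a]"]) auto
  next
    case False
    obtain j where j: "a j \<noteq> 0"
      using a by (auto simp: multiset_poset_def)
    then have jk: "j \<in> {1..k}"
      using a by (auto simp: multiset_poset_def)
    define b where "b = a(j := a j - 1)"
    have "sum b ({1..k} - {j}) = sum a ({1..k} - {j})"
      by (rule sum.cong) (auto simp: b_def)
    then have sum: "Suc (sum b {1..k}) = sum a {1..k}"
      using j by (subst (1 2) sum.remove[OF _ jk]) (auto simp: b_def)
    have "sum b {1..k} \<noteq> 0"
      using False sum by linarith
    then obtain i where "b i \<noteq> 0"
      by (rule sum.not_neutral_contains_not_neutral)
    moreover have ba: "b \<le> a"
      by (auto simp: b_def le_fun_def)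
    ultimately have b: "b \<in> multiset_poset k n"
      using a unfolding multiset_poset_def le_fun_def
      by simp (metis le_zero_eq order_trans)
    have "b j < a j"
      using j by (simp add: b_def)
    then have "b < a"
      using ba by (auto simp: less_le)
    obtain zs where zs: "zs \<noteq> []" "hd zs = b" "set zs \<subseteq> multiset_poset k n" "sorted_wrt (>) zs"
      "length zs = sum b {1..k}"
      using less.hyps[OF _ b] sum by auto
    have "z < a" if "z \<in> set zs" for z
      using that zs(1,2,4) \<open>b < a\<close> by (cases zs) (auto dest: less_trans)
    then show ?thesis
      using zs a sum by (intro exI[of _ "a # zs"]) auto
  qed
qed

lemma height_multiset_poset:
  assumes "a \<in> multiset_poset k n"
  shows "height (multiset_poset k n) a = sum a {1..k}"
proof -
  let ?S = "{length zs |zs. zs \<noteq> [] \<and> hd zs = a \<and> set zs \<subseteq> multiset_poset k n \<and>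
    sorted_wrt (>) zs}"
  have le: "l \<le> sum a {1..k}" if "l \<in> ?S" for l
    using that length_chain_le by blast
  moreover have "finite ?S"
    by (rule finite_subset[of _ "{..sum a {1..k}}"]) (use le in blast, simp)
  moreover have "sum a {1..k} \<in> ?S"
    using ex_chain_of_length_sum[OF assms] by force
  ultimately show ?thesis
    unfolding height_def by (intro Max_eqI) auto
qed

section \<open>Sums of a monotone function over sets of given size\<close>

lemma sum_initial_le:
  fixes n :: "nat \<Rightarrow> nat"
  assumes "mono_on {1..k} n" "S \<subseteq> {1..k}" "c \<le> card S"
  shows "sum n {1..c} \<le> sum n S"
  using assms(2,3)
proof (induction c arbitrary: S)
  case (Suc c)
  have fin: "finite S"
    using Suc.prems(1) finite_subset by blast
  have ne: "S \<noteq> {}"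
    using Suc.prems(2) by auto
  define M where "M = Max S"
  have M: "M \<in> S"
    using fin ne by (simp add: M_def)
  have "S \<subseteq> {1..M}"
    using fin Suc.prems(1) by (auto simp: M_def)
  then have "Suc c \<le> M"
    using card_mono[of "{1..M}" S] Suc.prems(2) by simp
  then have "n (Suc c) \<le> n M"
    using M Suc.prems(1) by (intro mono_onD[OF assms(1)]) auto
  moreover have "sum n {1..c} \<le> sum n (S - {M})"
    using Suc.prems M by (intro Suc.IH) (auto simp: card_Diff_singleton)
  ultimately show ?case
    by (simp add: sum.remove[OF fin M])
qed simp

lemma sum_le_final:
  fixes n :: "nat \<Rightarrow> nat"
  assumes "mono_on {1..k} n" "S \<subseteq> {1..k}" "card S \<le> c" "c \<le> k"
  shows "sum n S \<le> sum n {k - c + 1..k}"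
proof -
  have "sum n {1..k - c} \<le> sum n ({1..k} - S)"
    using assms finite_subset[OF assms(2)] by (intro sum_initial_le[of k]) (auto simp: card_Diff_subset)
  moreover have "sum n {1..k} = sum n S + sum n ({1..k} - S)"
    using sum.subset_diff[OF assms(2), of n] by (simp add: add.commute)
  moreover have "sum n {1..k} = sum n {1..k - c} + sum n {k - c + 1..k}"
  proof -
    have "{1..k} = {1..k - c} \<union> {k - c + 1..k}"
      using assms(4) by auto
    then show ?thesis
      by (simp only:) (rule sum.union_disjoint; auto)
  qed
  ultimately show ?thesis
    by linarith
qed

section \<open>The upper bound\<close>

text \<open>
  The average outdegree is at most \<open>(card V - 1) / 2\<close>, because the relation and its converse are
  disjoint and miss the diagonal.
\<close>

lemma asymmetric_relation_small_outdegree: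
  assumes "finite V" "V \<noteq> {}"
    and asym: "\<And>i j. i \<in> V \<Longrightarrow> j \<in> V \<Longrightarrow> R i j \<Longrightarrow> \<not> R j i"
  shows "\<exists>i\<in>V. 2 * card {j \<in> V. R i j} < card V"
proof (rule ccontr)
  assume "\<not> ?thesis"
  then have ge: "card V \<le> 2 * card {j \<in> V. R i j}" if "i \<in> V" for i
    using that by force
  define E where "E = (SIGMA i:V. {j \<in> V. R i j})"
  have fin: "finite E"
    using assms(1) by (simp add: E_def)
  have "card V * card V = (\<Sum>i\<in>V. card V)"
    by simp
  also have "\<dots> \<le> (\<Sum>i\<in>V. 2 * card {j \<in> V. R i j})"
    using ge by (rule sum_mono)
  also have "\<dots> = 2 * card E"
    using assms(1) by (simp add: E_def sum_distrib_left)
  also have "\<dots> = card (E \<union> E\<inverse>)"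
  proof -
    have "E \<inter> E\<inverse> = {}"
      using asym by (auto simp: E_def)
    then show ?thesis
      using fin by (simp add: card_Un_disjoint)
  qed
  also have "\<dots> < card (V \<times> V)"
  proof (rule psubset_card_mono)
    obtain v where "v \<in> V"
      using assms(2) by blast
    then have "(v, v) \<in> V \<times> V" "(v, v) \<notin> E \<union> E\<inverse>"
      using asym by (auto simp: E_def)
    then show "E \<union> E\<inverse> \<subset> V \<times> V"
      by (auto simp: E_def)
  qed (use assms(1) in simp)
  finally show False
    by (simp add: card_cartesian_product)
qed

lemma tdepth_partition_multiset_poset_le:
  fixes n :: "nat \<Rightarrow> nat"
  assumes "1 \<le> k" "\<forall>i\<in>{1..k}. 0 < n i" "mono_on {1..k} n"
    and \<pi>: "interval_partition (multiset_poset k n) \<pi>"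
  shows "tdepth_partition (multiset_poset k n) \<pi> \<le> sum n {k - (k + 1) div 2 + 1..k}"
proof -
  let ?P = "multiset_poset k n"
  define e :: "nat \<Rightarrow> nat \<Rightarrow> nat" where "e i = (\<lambda>j. if j = i then 1 else 0)" for i
  have eP: "e i \<in> ?P" if "i \<in> {1..k}" for i
    using that assms(2) by (force simp: multiset_poset_def e_def Suc_le_eq)
  have e_minimal: "a = e i" if a: "a \<in> ?P" "a \<le> e i" for a i
  proof -
    have le: "a j \<le> e i j" for j
      using a(2) by (simp add: le_fun_def)
    obtain j where "a j \<noteq> 0"
      using a(1) by (auto simp: multiset_poset_def)
    then have "a i = 1"
      using le[of j] le[of i] by (cases "j = i") (auto simp: e_def)
    show ?thesis
    proof
      show "a j = e i j" for j
        using \<open>a i = 1\<close> le[of j] by (simp add: e_def split: if_splits)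
    qed
  qed
  have "\<exists>Y. Y \<in> ?P \<and> e i \<le> Y \<and> poset_interval ?P (e i) Y \<in> \<pi>" if i: "i \<in> {1..k}" for i
  proof -
    have "e i \<in> \<Union> \<pi>"
      using eP[OF i] \<pi> by (simp add: interval_partition_def partition_on_def)
    then obtain I where I: "I \<in> \<pi>" "e i \<in> I"
      by blast
    then obtain X Y where XY: "X \<in> ?P" "Y \<in> ?P" "X \<le> Y" "I = poset_interval ?P X Y"
      using \<pi> unfolding interval_partition_def by blast
    then have "X = e i"
      using I(2) e_minimal by (auto simp: poset_interval_def)
    then show ?thesis
      using XY I(1) by auto
  qed
  then obtain Y where Y: "\<And>i. i \<in> {1..k} \<Longrightarrow>
      Y i \<in> ?P \<and> e i \<le> Y i \<and> poset_interval ?P (e i) (Y i) \<in> \<pi>"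
    by metis
  define R where "R i j \<longleftrightarrow> i \<noteq> j \<and> 0 < Y i j" for i j
  have asym: "\<not> R j i" if ij: "i \<in> {1..k}" "j \<in> {1..k}" "R i j" for i j
  proof
    assume "R j i"
    define c where "c = (\<lambda>l. e i l + e j l)"
    have "i \<noteq> j"
      using ij(3) by (simp add: R_def)
    then have "c l \<le> n l" if "l \<in> {1..k}" for l
      using assms(2) that by (simp add: c_def e_def Suc_le_eq)
    moreover have "c l = 0" if "l \<notin> {1..k}" for l
      using ij(1,2) that by (auto simp: c_def e_def)
    moreover have "c i \<noteq> 0"
      by (simp add: c_def e_def)
    ultimately have cP: "c \<in> ?P"
      unfolding multiset_poset_def by blast
    have "e i i \<le> Y i i" "e j j \<le> Y j j"
      using Y ij(1,2) by (auto simp: le_fun_def)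
    then have "c l \<le> Y i l" "c l \<le> Y j l" for l
      using ij(3) \<open>R j i\<close> by (auto simp: c_def e_def R_def)
    then have "c \<le> Y i" "c \<le> Y j"
      by (auto simp: le_fun_def)
    moreover have "e i \<le> c" "e j \<le> c"
      by (auto simp: c_def le_fun_def)
    ultimately have "c \<in> poset_interval ?P (e i) (Y i)" "c \<in> poset_interval ?P (e j) (Y j)"
      using cP by (auto simp: poset_interval_def)
    moreover have "disjoint \<pi>"
      using \<pi> by (simp add: interval_partition_def partition_on_def)
    ultimately have eq: "poset_interval ?P (e i) (Y i) = poset_interval ?P (e j) (Y j)"
      using Y[OF ij(1)] Y[OF ij(2)] disjointD[of \<pi>] by blast
    have "e i = e j"
      using Y[OF ij(1)] Y[OF ij(2)] eP[OF ij(1)] eP[OF ij(2)]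
      by (intro poset_interval_eqD(1)[OF _ _ _ _ _ _ eq]) auto
    then have "e i i = e j i"
      by simp
    then show False
      using \<open>i \<noteq> j\<close> by (simp add: e_def)
  qed
  have "\<exists>i\<in>{1..k}. 2 * card {j \<in> {1..k}. R i j} < card {1..k}"
    using assms(1) by (intro asymmetric_relation_small_outdegree asym) simp_all
  then obtain i where i: "i \<in> {1..k}" "2 * card {j \<in> {1..k}. R i j} < k"
    by auto
  let ?S = "insert i {j \<in> {1..k}. R i j}"
  have "card ?S \<le> (k + 1) div 2"
    using i(2) by (subst card_insert_disjoint) (auto simp: R_def)
  have "tdepth_partition ?P \<pi> \<le> height ?P (Y i)"
    using Y[OF i(1)] eP[OF i(1)] finite_multiset_poset by (intro tdepth_partition_le) auto
  also have "\<dots> = sum (Y i) {1..k}"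
    using Y[OF i(1)] by (intro height_multiset_poset) auto
  also have "\<dots> = sum (Y i) ?S"
    using i(1) by (intro sum.mono_neutral_right) (auto simp: R_def)
  also have "\<dots> \<le> sum n ?S"
    using Y[OF i(1)] i(1) by (intro sum_mono) (auto simp: multiset_poset_def)
  also have "\<dots> \<le> sum n {k - (k + 1) div 2 + 1..k}"
    by (rule sum_le_final[OF assms(3)])
      (use i(1) assms(1) \<open>card ?S \<le> (k + 1) div 2\<close> in auto)
  finally show ?thesis .
qed

section \<open>Partitioning the nonempty subsets of an interval of integers\<close>

text \<open>
  The parity of the last element of \<open>A\<close> up to \<open>y\<close>, where \<open>True\<close> stands for even. Before the first
  element of \<open>A\<close>, the last element of \<open>A\<close> is found by going backwards around a circle of odd length;
  the change of representative by an odd number turns the parity of \<open>Max A\<close> into its opposite.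
\<close>

definition last_parity :: "nat set \<Rightarrow> nat \<Rightarrow> bool" where
  "last_parity A y = (if A \<inter> {..y} = {} then odd (Max A) else even (Max (A \<inter> {..y})))"

text \<open>
  The lower set keeps the elements at which the parity changes, the starts of the runs of equal
  parity on the circle; the upper set consists of all points that may be added without disturbing
  the parities.
\<close>

definition lower_set :: "nat \<Rightarrow> nat set \<Rightarrow> nat set" where
  "lower_set k A = {y \<in> {1..k}. last_parity A y \<noteq> last_parity A (y - 1)}"

definition upper_set :: "nat \<Rightarrow> nat set \<Rightarrow> nat set" where
  "upper_set k A = {y \<in> {1..k}. last_parity A y = even y}"

lemma last_parity_mem:
  assumes "y \<in> A"
  shows "last_parity A y = even y"
proof -
  have "Max (A \<inter> {..y}) = y"
    using assms by (intro Max_eqI) auto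
  then show ?thesis
    using assms by (auto simp: last_parity_def)
qed

lemma last_parity_not_mem:
  assumes "y \<notin> A"
  shows "last_parity A y = last_parity A (y - 1)"
proof -
  have "A \<inter> {..y} = A \<inter> {..y - 1}"
  proof (rule set_eqI)
    fix x
    have "x \<noteq> y" if "x \<in> A"
      using assms that by auto
    then show "x \<in> A \<inter> {..y} \<longleftrightarrow> x \<in> A \<inter> {..y - 1}"
      by auto
  qed
  then show ?thesis
    by (simp add: last_parity_def)
qed

lemma lower_subset: "lower_set k A \<subseteq> A"
  using last_parity_not_mem by (auto simp: lower_set_def)

lemma subset_upper: "A \<subseteq> {1..k} \<Longrightarrow> A \<subseteq> upper_set k A"
  using last_parity_mem by (auto simp: upper_set_def)

lemma last_parity_0: "A \<subseteq> {1..k} \<Longrightarrow> last_parity A 0 = odd (Max A)"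
  by (auto simp: last_parity_def)

lemma last_parity_end:
  assumes "A \<subseteq> {1..k}" "A \<noteq> {}" "k \<le> y"
  shows "last_parity A y = even (Max A)"
proof -
  have "A \<inter> {..y} = A"
    using assms by auto
  then show ?thesis
    using assms by (simp add: last_parity_def)
qed

lemma last_parity_constant:
  assumes "x \<le> y" "y \<le> k" "\<And>z. x < z \<Longrightarrow> z \<le> y \<Longrightarrow> z \<notin> lower_set k A"
  shows "last_parity A y = last_parity A x"
  using assms
proof (induction y rule: dec_induct)
  case (step y)
  then have "Suc y \<notin> lower_set k A"
    by auto
  then have "last_parity A (Suc y) = last_parity A y"
    using step.prems by (auto simp: lower_set_def)
  then show ?case
    using step by auto
qed simp

lemma lower_nonempty:
  assumes "A \<subseteq> {1..k}" "A \<noteq> {}"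
  shows "lower_set k A \<noteq> {}"
  using last_parity_constant[of 0 k k A] last_parity_0[OF assms(1)]
    last_parity_end[OF assms order_refl] by auto

text \<open>
  Elements of \<open>B\<close> lie in the upper set of \<open>A\<close>, so they agree with the current parity of \<open>A\<close>; and
  the parity of \<open>A\<close> changes only at elements of \<open>B\<close>. Hence the parity of \<open>A\<close> is always that of the last
  element of \<open>B\<close>, first after the minimum of \<open>B\<close> and then, as the initial parity is determined
  by the final one, everywhere.
\<close>

lemma last_parity_eq_if_between:
  assumes A: "A \<subseteq> {1..k}" "A \<noteq> {}"
    and B: "lower_set k A \<subseteq> B" "B \<subseteq> upper_set k A"
    and "y \<le> k"
  shows "last_parity B y = last_parity A y"
proof -
  have Bk: "B \<subseteq> {1..k}"
    using B(2) by (auto simp: upper_set_def)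
  have Bne: "B \<noteq> {}"
    using lower_nonempty[OF A] B(1) by auto
  have eq: "last_parity B y = last_parity A y" if "B \<inter> {..y} \<noteq> {}" "y \<le> k" for y
  proof -
    define b where "b = Max (B \<inter> {..y})"
    have b: "b \<in> B" "b \<le> y"
      using that(1) Max_in[of "B \<inter> {..y}"] by (auto simp: b_def)
    have "z \<notin> lower_set k A" if z: "b < z" "z \<le> y" for z
    proof
      assume "z \<in> lower_set k A"
      then have "z \<in> B \<inter> {..y}"
        using B(1) z by auto
      then have "z \<le> b"
        unfolding b_def by (intro Max_ge) auto
      then show False
        using z by simp
    qed
    then have "last_parity A y = last_parity A b"
      using b that(2) by (intro last_parity_constant) auto
    also have "\<dots> = even b"
      using b B(2) by (auto simp: upper_set_def)
    finally show ?thesis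
      using that(1) by (simp add: last_parity_def b_def)
  qed
  show ?thesis
  proof (cases "B \<inter> {..y} = {}")
    case True
    have "B \<inter> {..k} \<noteq> {}"
      using Bk Bne by fastforce
    then have "even (Max B) = even (Max A)"
      using eq[of k] last_parity_end[OF Bk Bne] last_parity_end[OF A] by simp
    moreover have "last_parity A y = last_parity A 0"
      using True B(1) \<open>y \<le> k\<close> by (intro last_parity_constant) auto
    ultimately show ?thesis
      using True last_parity_0[OF A(1)] by (simp add: last_parity_def)
  qed (use eq \<open>y \<le> k\<close> in auto)
qed

corollary bounds_eq_if_between:
  assumes "A \<subseteq> {1..k}" "A \<noteq> {}" "lower_set k A \<subseteq> B" "B \<subseteq> upper_set k A"
  shows "lower_set k B = lower_set k A" "upper_set k B = upper_set k A"
  using last_parity_eq_if_between[OF assms] by (auto simp: lower_set_def upper_set_def)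

text \<open>
  A point outside the upper set is followed on the circle by a point of the upper set: if the parity
  changes at the second point, then this point belongs to \<open>A\<close>; otherwise the parity agrees with
  exactly one of the two points. So the cyclic successor maps the complement injectively into the
  upper set.
\<close>

lemma card_upper:
  assumes "A \<subseteq> {1..k}" "A \<noteq> {}"
  shows "(k + 1) div 2 \<le> card (upper_set k A)"
proof -
  (* The odd number among k and k + 1. *)
  define l where "l = 2 * (k div 2) + 1"
  have l: "k \<le> l" "odd l" "l \<le> k + 1"
    by (auto simp: l_def)
  define s where "s y = (if y = l then 1 else y + 1)" for y
  have follow: "s y \<in> upper_set l A" if y: "y \<in> {1..l} - upper_set l A" for y
  proof (cases "y = l")
    case True
    then have "even (Max A)"
      using y l last_parity_end[OF assms, of l] by (auto simp: upper_set_def)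
    then have "last_parity A 1 = even 1"
      using last_parity_mem[of 1 A] last_parity_not_mem[of 1 A] last_parity_0[OF assms(1)] by auto
    then show ?thesis
      using True l by (auto simp: s_def upper_set_def l_def)
  next
    case False
    have "last_parity A (y + 1) = even (y + 1)"
      using y last_parity_mem[of "y + 1" A] last_parity_not_mem[of "y + 1" A]
      by (auto simp: upper_set_def)
    then show ?thesis
      using False y by (auto simp: s_def upper_set_def)
  qed
  have "inj_on s ({1..l} - upper_set l A)"
    by (auto simp: inj_on_def s_def split: if_splits)
  then have "card ({1..l} - upper_set l A) \<le> card (upper_set l A)"
  proof (rule card_inj_on_le)
    show "s ` ({1..l} - upper_set l A) \<subseteq> upper_set l A"
      using follow by (rule image_subsetI)
    show "finite (upper_set l A)"
      by (simp add: upper_set_def)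
  qed
  moreover have "upper_set l A \<subseteq> {1..l}"
    by (auto simp: upper_set_def)
  ultimately have "l \<le> 2 * card (upper_set l A)"
    by (simp add: card_Diff_subset finite_subset)
  moreover have "card (upper_set l A) \<le> card (upper_set k A \<union> {k + 1..l})"
    using l by (intro card_mono) (auto simp: upper_set_def)
  moreover have "\<dots> \<le> card (upper_set k A) + (l - k)"
    using card_Un_le[of "upper_set k A" "{k + 1..l}"] by simp
  ultimately show ?thesis
    unfolding l_def by presburger
qed

section \<open>The lower bound\<close>

lemma ex_deep_interval_partition:
  fixes n :: "nat \<Rightarrow> nat"
  assumes "1 \<le> k" "\<forall>i\<in>{1..k}. 0 < n i" "mono_on {1..k} n"
  shows "\<exists>\<pi>. interval_partition (multiset_poset k n) \<pi> \<and>
    sum n {1..(k + 1) div 2} \<le> tdepth_partition (multiset_poset k n) \<pi>"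
proof -
  let ?P = "multiset_poset k n"
  define supp :: "(nat \<Rightarrow> nat) \<Rightarrow> nat set" where "supp a = {j. a j \<noteq> 0}" for a
  define lo :: "(nat \<Rightarrow> nat) \<Rightarrow> nat \<Rightarrow> nat"
    where "lo a = (\<lambda>j. if j \<in> lower_set k (supp a) then 1 else 0)" for a
  define hi where "hi a = (\<lambda>j. if j \<in> upper_set k (supp a) then n j else 0)" for a
  define \<pi> where "\<pi> = (\<lambda>a. poset_interval ?P (lo a) (hi a)) ` ?P"
  have supp: "supp a \<subseteq> {1..k}" "supp a \<noteq> {}" if "a \<in> ?P" for a
    using that by (auto simp: multiset_poset_def supp_def)
  have bounds: "lo a \<in> ?P \<and> hi a \<in> ?P \<and> lo a \<le> a \<and> a \<le> hi a" if a: "a \<in> ?P" for a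
  proof -
    have sub: "lower_set k (supp a) \<subseteq> supp a" "supp a \<subseteq> upper_set k (supp a)"
      using lower_subset subset_upper[OF supp(1)[OF a]] by auto
    have "lo a \<le> a"
      using sub(1) by (auto simp: le_fun_def lo_def supp_def Suc_le_eq)
    moreover have "a \<le> hi a"
    proof (rule le_funI)
      show "a j \<le> hi a j" for j
        using sub(2) a by (cases "a j = 0") (auto simp: hi_def supp_def multiset_poset_def)
    qed
    moreover have "lo a \<in> ?P"
    proof -
      obtain j where "j \<in> lower_set k (supp a)"
        using lower_nonempty[OF supp[OF a]] by blast
      then have "lo a j \<noteq> 0"
        by (simp add: lo_def)
      moreover have "lo a j \<le> n j" if "j \<in> {1..k}" for j
        using assms(2) that by (simp add: lo_def Suc_le_eq)
      moreover have "lo a j = 0" if "j \<notin> {1..k}" for j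
        using that by (auto simp: lo_def lower_set_def)
      ultimately show ?thesis
        unfolding multiset_poset_def by blast
    qed
    moreover have "hi a \<in> ?P"
    proof -
      obtain j where "a j \<noteq> 0"
        using supp(2)[OF a] by (auto simp: supp_def)
      then have "hi a j \<noteq> 0"
        using \<open>a \<le> hi a\<close> by (metis le_funD le_zero_eq)
      moreover have "hi a j \<le> n j" for j
        by (simp add: hi_def)
      moreover have "hi a j = 0" if "j \<notin> {1..k}" for j
        using that by (auto simp: hi_def upper_set_def)
      ultimately show ?thesis
        unfolding multiset_poset_def by blast
    qed
    ultimately show ?thesis
      by blast
  qed
  have const: "lo b = lo a \<and> hi b = hi a"
    if a: "a \<in> ?P" and ab: "lo a \<le> b" "b \<le> hi a" for a b
  proof -
    have "b j \<noteq> 0" if "j \<in> lower_set k (supp a)" for j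
      using le_funD[OF ab(1), of j] that by (simp add: lo_def)
    moreover have "j \<in> upper_set k (supp a)" if "b j \<noteq> 0" for j
      using le_funD[OF ab(2), of j] that by (simp add: hi_def split: if_splits)
    ultimately have "lower_set k (supp a) \<subseteq> supp b" "supp b \<subseteq> upper_set k (supp a)"
      by (auto simp: supp_def)
    then show ?thesis
      using bounds_eq_if_between[OF supp[OF a]] by (simp add: lo_def hi_def)
  qed
  have part: "interval_partition ?P \<pi>"
    unfolding \<pi>_def by (intro interval_partition_of_bounds bounds const)
  have high: "sum n {1..(k + 1) div 2} \<le> height ?P Y"
    if XY: "X \<in> ?P" "Y \<in> ?P" "X \<le> Y" "poset_interval ?P X Y \<in> \<pi>" for X Y
  proof -
    obtain a where a: "a \<in> ?P" "poset_interval ?P X Y = poset_interval ?P (lo a) (hi a)"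
      using XY(4) by (auto simp: \<pi>_def)
    then have Y: "Y = hi a"
      using poset_interval_eqD(2)[OF XY(1-3)] bounds[OF a(1)] by (meson order_trans)
    have sub: "upper_set k (supp a) \<subseteq> {1..k}"
      by (auto simp: upper_set_def)
    have "sum n {1..(k + 1) div 2} \<le> sum n (upper_set k (supp a))"
      by (rule sum_initial_le[OF assms(3) sub card_upper[OF supp[OF a(1)]]])
    also have "\<dots> = sum (hi a) (upper_set k (supp a))"
      by (simp add: hi_def)
    also have "\<dots> = sum (hi a) {1..k}"
      using sub by (intro sum.mono_neutral_left) (auto simp: hi_def)
    also have "\<dots> = height ?P Y"
      using XY(2) Y by (simp add: height_multiset_poset)
    finally show ?thesis .
  qed
  have "(\<lambda>j. if j = 1 then 1 else 0) \<in> ?P"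
    using assms(1,2) by (auto simp: multiset_poset_def Suc_le_eq)
  then have "sum n {1..(k + 1) div 2} \<le> tdepth_partition ?P \<pi>"
    by (intro tdepth_partition_ge finite_multiset_poset part high) auto
  then show ?thesis
    using part by blast
qed

section \<open>The bounds on the total depth\<close>

theorem theorem5p2:
  fixes k :: nat and n :: "nat \<Rightarrow> nat"
  assumes "k \<ge> 1"
    and "\<forall>i\<in>{1..k}. 0 < n i"
    and "mono_on {1..k} n"
  shows "(\<Sum>i = 1..nat \<lceil>real k / 2\<rceil>. n i) \<le> tdepth (multiset_poset k n)
    \<and> tdepth (multiset_poset k n) \<le> (\<Sum>i = k - nat \<lceil>real k / 2\<rceil> + 1..k. n i)"
proof -
  let ?P = "multiset_poset k n"
  have half: "nat \<lceil>real k / 2\<rceil> = (k + 1) div 2"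
    by linarith
  obtain \<pi> where \<pi>: "interval_partition ?P \<pi>"
      "sum n {1..(k + 1) div 2} \<le> tdepth_partition ?P \<pi>"
    using ex_deep_interval_partition[OF assms] by blast
  have "sum n {1..(k + 1) div 2} \<le> tdepth ?P"
    using \<pi> tdepth_partition_le_tdepth[OF finite_multiset_poset \<pi>(1)] by linarith
  moreover have "tdepth ?P \<le> sum n {k - (k + 1) div 2 + 1..k}"
    using \<pi>(1) tdepth_partition_multiset_poset_le[OF assms]
    by (intro tdepth_le finite_multiset_poset)
  ultimately show ?thesis
    unfolding half by blast
qed

end
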